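(* For $n\ge3$ and $i\in[n]$ let $d(n,i)=|\{\pi\in\mathrm{Av}_n^{123}(123,231):\pi_1=i\}|$. Then $$\Pr(123\prec231)=\sum_{n\ge3}\frac{1}{n!}\sum_{i=1}^n d(n,i)\approx0.550.$$
   Context: For a sequence of distinct reals, $\mathrm{st}$ replaces the smallest entry by $1$, the second smallest by $2$, etc. Let $X_1,X_2,\dots$ be i.i.d. continuous random variables (e.g. uniform on $[0,1]$). A consecutive occurrence of a permutation $\sigma$ of $\{1,\dots,k\}$ in a sequence or permutation is a block of $k$ adjacent entries whose standardization is $\sigma$. For distinct permutations $\sigma,\tau$ of the same length, $\Pr(\sigma\prec\tau)$ is the probability that the first consecutive occurrence of $\sigma$ in $X_1,X_2,\dots$ appears before the first consecutive occurrence of $\tau$. $\mathrm{Av}_n^{123}(123,231)$ is the set of permutations of $[n]=\{1,\dots,n\}$ whose last three entries form a consecutive occurrence of $123$ and which have no other consecutive occurrence of $123$ or $231$. *)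

theory Defs
  imports "HOL-Probability.Probability" "HOL-Combinatorics.Multiset_Permutations"
begin

text \<open>Permutations of \<open>{1..k}\<close> are written in one-line notation, as lists of natural numbers;
  positions are counted from \<open>0\<close>, so the random variables \<open>X\<^sub>1, X\<^sub>2, \<dots>\<close> are \<open>X 0, X 1, \<dots>\<close>.\<close>

text \<open>Standardization. If the entries of \<open>xs\<close> are not distinct, the value is not a permutation of
  \<open>{1..length xs}\<close>, so that such a block is not an occurrence of any permutation.\<close>

definition st :: "'a::linorder list \<Rightarrow> nat list" where
  "st xs = map (\<lambda>x. card {y \<in> set xs. y \<le> x}) xs"

definition occurs_at :: "nat list \<Rightarrow> 'a::linorder list \<Rightarrow> nat \<Rightarrow> bool" where
  "occurs_at \<sigma> xs i \<longleftrightarrow> i + length \<sigma> \<le> length xs \<and> st (take (length \<sigma>) (drop i xs)) = \<sigma>"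

definition seq_occurs_at :: "nat list \<Rightarrow> (nat \<Rightarrow> 'a::linorder) \<Rightarrow> nat \<Rightarrow> bool" where
  "seq_occurs_at \<sigma> x i \<longleftrightarrow> st (map x [i..<i + length \<sigma>]) = \<sigma>"

text \<open>Starting position of the first occurrence, \<open>\<infinity>\<close> if there is none. For patterns of the same
  length, comparing starting positions is the same as comparing end positions.\<close>

definition first_occ :: "nat list \<Rightarrow> (nat \<Rightarrow> 'a::linorder) \<Rightarrow> enat" where
  "first_occ \<sigma> x = Inf (enat ` {i. seq_occurs_at \<sigma> x i})"

definition Pr_prec :: "'a measure \<Rightarrow> (nat \<Rightarrow> 'a \<Rightarrow> real) \<Rightarrow> nat list \<Rightarrow> nat list \<Rightarrow> real" where
  "Pr_prec M X \<sigma> \<tau> =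
     measure M {\<omega> \<in> space M. first_occ \<sigma> (\<lambda>n. X n \<omega>) < first_occ \<tau> (\<lambda>n. X n \<omega>)}"

text \<open>The set usually written \<open>Av\<^sub>n\<^sup>\<sigma>(B)\<close>: the last entries of \<open>\<pi>\<close> form an occurrence of \<open>\<sigma>\<close>, and
  this is the only occurrence in \<open>\<pi>\<close> of a pattern in \<open>B\<close>.\<close>

definition Av_end :: "nat \<Rightarrow> nat list \<Rightarrow> nat list set \<Rightarrow> nat list set" where
  "Av_end n \<sigma> B = {\<pi> \<in> permutations_of_set {1..n}. length \<sigma> \<le> n \<and> occurs_at \<sigma> \<pi> (n - length \<sigma>) \<and>
     (\<forall>\<rho>\<in>B. \<forall>i. occurs_at \<rho> \<pi> i \<longrightarrow> \<rho> = \<sigma> \<and> i = n - length \<sigma>)}"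

definition d :: "nat \<Rightarrow> nat \<Rightarrow> nat" where
  "d n i = card {\<pi> \<in> Av_end n [1, 2, 3] {[1, 2, 3], [2, 3, 1]}. hd \<pi> = i}"

end

theory Submission
  imports Defs
begin

text \<open>Since the variables are independent with a common continuous distribution, they are almost
  surely distinct and all \<open>n!\<close> relative orders of the first \<open>n\<close> of
  them are equally likely. Therefore an event that depends only on this relative order has
  probability \<open>k / n!\<close>, where \<open>k\<close> counts the permutations with the
  property (\<open>prob_order_type\<close>). The event that \<open>123\<close> comes first is
  the disjoint union over \<open>n\<close> of the events that the first occurrence of either
  pattern is a \<open>123\<close> ending at the \<open>n\<close>-th entry, called a win at time
  \<open>n\<close> (\<open>first_occ_less_iff\<close>, \<open>wins_unique\<close>). The
  permutations belonging to the \<open>n\<close>-th event are those counted by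
  \<open>d n 1, \<dots>, d n n\<close> (\<open>Av_end_eq\<close>), so countable additivity gives
  the series.

  For the numerical value, let \<open>S\<close> be the partial sum up to \<open>n = 24\<close>
  and let \<open>r\<close> be the probability that the first \<open>24\<close> entries contain
  neither pattern. The probability in question lies between \<open>S\<close> and
  \<open>S + r\<close>, because a win after time \<open>24\<close> needs a pattern-free start.
  Both numbers come from counting permutations by their first entry
  (\<open>card_arrangements\<close>). If the second entry is smaller than the first, the first
  one can be removed, since neither pattern starts with a descent. If it is larger and no
  pattern is formed, then the third entry lies between the first two, and both can be removed.
  This recursion is evaluated with integer arithmetic (\<open>table_values\<close>).\<close>

section \<open>Arrangements that stop at 123 or avoid both patterns\<close>

text \<open>\<open>match_at x i\<close> covers both patterns at once: the block starting at \<open>i\<close>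
  begins with an ascent, and its third entry lies above the other two (\<open>123\<close>) or
  below them (\<open>231\<close>). Working with functions on positions makes one definition
  serve for random sequences and, through \<open>(!)\<close>, for permutations.\<close>
definition match_at :: "(nat \<Rightarrow> 'a::linorder) \<Rightarrow> nat \<Rightarrow> bool" where
  "match_at x i \<longleftrightarrow> x i < x (i + 1) \<and> (x (i + 1) < x (i + 2) \<or> x (i + 2) < x i)"

definition pattern_free :: "(nat \<Rightarrow> 'a::linorder) \<Rightarrow> nat \<Rightarrow> bool" where
  "pattern_free x m \<longleftrightarrow> (\<forall>i<m. \<not> match_at x i)"

definition wins :: "(nat \<Rightarrow> 'a::linorder) \<Rightarrow> nat \<Rightarrow> bool" where
  "wins x n \<longleftrightarrow> 3 \<le> n \<and> x (n - 3) < x (n - 2) \<and> x (n - 2) < x (n - 1) \<and> pattern_free x (n - 3)"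

text \<open>The two families of permutations that are counted: for \<open>w = True\<close> those that stop
  with a \<open>123\<close> exactly at their end, for \<open>w = False\<close> those that
  contain neither pattern. They obey the same recursion from length \<open>4\<close> on and
  differ only in the counts for shorter lists.\<close>
definition outcome :: "bool \<Rightarrow> 'a::linorder list \<Rightarrow> bool" where
  "outcome w xs = (if w then wins ((!) xs) (length xs) else pattern_free ((!) xs) (length xs - 2))"

lemma pattern_free_Cons: "pattern_free ((!) (x # xs)) (Suc m) \<longleftrightarrow> \<not> match_at ((!) (x # xs)) 0 \<and> pattern_free ((!) xs) m"
  unfolding pattern_free_def by (subst All_less_Suc2) (simp add: match_at_def)

lemma outcome_short: "outcome w [x] \<longleftrightarrow> \<not> w" "outcome w [x, y] \<longleftrightarrow> \<not> w"
  by (auto simp: outcome_def wins_def pattern_free_def)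

lemma outcome_Cons:
  "outcome w (x # y # z # zs) \<longleftrightarrow>
     (w \<and> zs = [] \<and> x < y \<and> y < z) \<or>
     (\<not> (x < y \<and> (y < z \<or> z < x)) \<and> outcome w (y # z # zs))"
proof (cases "w \<and> zs \<noteq> []")
  case True
  then obtain u us where "zs = u # us" "w" by (cases zs) auto
  then show ?thesis
    by (auto simp: outcome_def wins_def pattern_free_Cons match_at_def)
next
  case False
  then consider "\<not> w" | "w" "zs = []" by blast
  then show ?thesis
  proof cases
    case 1
    then show ?thesis by (auto simp: outcome_def pattern_free_Cons match_at_def)
  next
    case 2
    then show ?thesis by (auto simp: outcome_def wins_def pattern_free_def)
  qed
qed

lemma outcome_descent:
  "y < x \<Longrightarrow> zs \<noteq> [] \<Longrightarrow> outcome w (x # y # zs) \<longleftrightarrow> outcome w (y # zs)"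
  by (cases zs) (auto simp: outcome_Cons)

text \<open>After an ascent \<open>x < y\<close> that is not completed to a pattern, the next entry
  \<open>z\<close> falls strictly between \<open>x\<close> and \<open>y\<close>. It is reached
  by a descent, and a block that starts with a descent matches no pattern; so \<open>x\<close>
  and \<open>y\<close> can both be forgotten.\<close>
lemma outcome_ascent:
  assumes "x < y" "distinct (x # y # z # zs)"
  shows "outcome w (x # y # z # zs) \<longleftrightarrow>
     (w \<and> zs = [] \<and> y < z) \<or> (x < z \<and> z < y \<and> outcome w (z # zs))"
proof (cases "zs = []")
  case True
  then show ?thesis using assms by (auto simp: outcome_Cons outcome_short)
next
  case False
  then show ?thesis
    using assms by (cases "z < y") (auto simp: outcome_Cons outcome_descent)
qed

section \<open>Counting by the first entry\<close>

text \<open>\<open>arrangement_count w n i\<close> is the number of arrangements of \<open>n\<close> numbers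
  whose first entry has exactly \<open>i\<close> smaller ones. The first sum is over a second
  entry below the first one. In the second sum the second entry is above, the third one lies
  between the two, and \<open>j\<close> counts the numbers below the third entry once the first
  two are removed; the factor is the number of possible second entries.\<close>
fun arrangement_count :: "bool \<Rightarrow> nat \<Rightarrow> nat \<Rightarrow> nat" where
  "arrangement_count w 0 i = 0"
| "arrangement_count w (Suc 0) i = of_bool (\<not> w)"
| "arrangement_count w (Suc (Suc 0)) i = of_bool (\<not> w)"
| "arrangement_count w (Suc (Suc (Suc m))) i =
     (\<Sum>j<i. arrangement_count w (Suc (Suc m)) j) + (\<Sum>j=i..m. (m + 1 - j) * arrangement_count w (Suc m) j)
     + of_bool (w \<and> m = 0 \<and> i = 0)"

definition rank_in :: "nat set \<Rightarrow> nat \<Rightarrow> nat" where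
  "rank_in A a = card {x \<in> A. x < a}"

lemma rank_in_less: assumes "finite A" "a \<in> A" "a < b" shows "rank_in A a < rank_in A b"
  unfolding rank_in_def by (rule psubset_card_mono) (use assms in auto)

lemma inj_on_rank_in: "finite A \<Longrightarrow> inj_on (rank_in A) A"
  by (rule inj_onI) (metis rank_in_less less_irrefl linorder_neqE_nat)

lemma rank_in_split:
  assumes "finite A" "a \<in> A"
  shows "card A = Suc (rank_in A a + card {x \<in> A. a < x})"
proof -
  have "A = insert a ({x \<in> A. x < a} \<union> {x \<in> A. a < x})" using assms by auto
  then have "card A = card (insert a ({x \<in> A. x < a} \<union> {x \<in> A. a < x}))" by simp
  also have "\<dots> = Suc (card ({x \<in> A. x < a} \<union> {x \<in> A. a < x}))"
    using assms by (subst card_insert_disjoint) auto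
  also have "card ({x \<in> A. x < a} \<union> {x \<in> A. a < x}) = rank_in A a + card {x \<in> A. a < x}"
    unfolding rank_in_def using assms by (subst card_Un_disjoint) auto
  finally show ?thesis .
qed

lemma bij_betw_rank_in_below:
  assumes "finite A" "a \<in> A"
  shows "bij_betw (rank_in A) {x \<in> A. x < a} {..<rank_in A a}"
proof -
  have i: "inj_on (rank_in A) {x \<in> A. x < a}"
    using inj_on_rank_in[OF assms(1)] by (rule inj_on_subset) auto
  have "rank_in A ` {x \<in> A. x < a} = {..<rank_in A a}"
  proof (rule card_subset_eq)
    show "rank_in A ` {x \<in> A. x < a} \<subseteq> {..<rank_in A a}" using assms by (auto simp: rank_in_less)
    show "card (rank_in A ` {x \<in> A. x < a}) = card {..<rank_in A a}"
      using i by (simp add: card_image) (simp add: rank_in_def)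
  qed simp
  with i show ?thesis by (simp add: bij_betw_def)
qed

lemma bij_betw_rank_in_above:
  assumes "finite A" "a \<in> A"
  shows "bij_betw (rank_in A) {x \<in> A. a < x} {rank_in A a<..<card A}"
proof -
  have i: "inj_on (rank_in A) {x \<in> A. a < x}"
    using inj_on_rank_in[OF assms(1)] by (rule inj_on_subset) auto
  have "rank_in A ` {x \<in> A. a < x} = {rank_in A a<..<card A}"
  proof (rule card_subset_eq)
    show "rank_in A ` {x \<in> A. a < x} \<subseteq> {rank_in A a<..<card A}"
      using assms rank_in_split[OF assms(1)] by (fastforce simp: rank_in_less)
    show "card (rank_in A ` {x \<in> A. a < x}) = card {rank_in A a<..<card A}"
      using i rank_in_split[OF assms] by (simp add: card_image)
  qed simp
  with i show ?thesis by (simp add: bij_betw_def)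
qed

definition arrangements :: "bool \<Rightarrow> nat set \<Rightarrow> nat \<Rightarrow> nat list set" where
  "arrangements w A a = {xs \<in> permutations_of_set A. hd xs = a \<and> outcome w xs}"

lemma finite_arrangements [simp]: "finite (arrangements w A a)"
  unfolding arrangements_def by simp

text \<open>The three ways to continue after the first entry \<open>a\<close>: a descent to
  \<open>b\<close>; an ascent to \<open>y\<close> followed by some \<open>z\<close> between
  \<open>a\<close> and \<open>y\<close>; or the terminal \<open>123\<close>.\<close>
lemma arrangements_decompose:
  assumes "finite A" "a \<in> A" "card A = Suc (Suc (Suc m))"
  shows "arrangements w A a =
     (\<Union>b\<in>{b \<in> A. b < a}. (#) a ` arrangements w (A - {a}) b)
   \<union> (\<Union>(z, y)\<in>(SIGMA z:{z \<in> A. a < z}. {y \<in> A. z < y}). (\<lambda>zs. a # y # zs) ` arrangements w (A - {a, y}) z)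
   \<union> {xs. w \<and> m = 0 \<and> (\<exists>y z. xs = [a, y, z] \<and> a < y \<and> y < z \<and> A = {a, y, z})}"
  (is "?L = ?R1 \<union> ?R2 \<union> ?R3")
proof (intro equalityI subsetI)
  fix xs assume "xs \<in> ?L"
  then have xs: "set xs = A" "distinct xs" "hd xs = a" "outcome w xs"
    by (auto simp: arrangements_def dest: permutations_of_setD)
  have len: "length xs = Suc (Suc (Suc m))" using xs assms distinct_card by metis
  then obtain y z zs where [simp]: "xs = a # y # z # zs" using xs(3)
    by (auto simp: length_Suc_conv)
  show "xs \<in> ?R1 \<union> ?R2 \<union> ?R3"
  proof (cases "y < a")
    case True
    have "y # z # zs \<in> arrangements w (A - {a}) y"
      using xs outcome_descent[of y a "z # zs" w] True by (auto simp: arrangements_def)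
    with True xs show ?thesis by auto
  next
    case False
    with xs have ay: "a < y" by auto
    with xs consider "w" "zs = []" "y < z" | "a < z" "z < y" "outcome w (z # zs)"
      using outcome_ascent[of a y z zs w] by auto
    then show ?thesis
    proof cases
      case 1
      then show ?thesis using xs ay len by auto
    next
      case 2
      then have "z # zs \<in> arrangements w (A - {a, y}) z"
        using xs by (auto simp: arrangements_def)
      with 2 ay xs show ?thesis by (auto simp: image_iff)
    qed
  qed
next
  fix xs assume "xs \<in> ?R1 \<union> ?R2 \<union> ?R3"
  then consider "xs \<in> ?R1" | "xs \<in> ?R2" | "xs \<in> ?R3" by blast
  then show "xs \<in> ?L"
  proof cases
    case 1
    then obtain b ys where b: "b \<in> A" "b < a" "xs = a # ys" "set ys = A - {a}" "distinct ys" "hd ys = b"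
      "outcome w ys" by (auto simp: arrangements_def dest: permutations_of_setD)
    have "length ys = Suc (Suc m)" using b assms distinct_card[of ys] by simp
    then obtain z zs where ys: "ys = b # z # zs" using b(6) by (auto simp: length_Suc_conv)
    have "outcome w xs" using outcome_descent[of b a "z # zs" w] b(2,3,7) unfolding ys by blast
    moreover have "xs \<in> permutations_of_set A" using b(3-5) assms(2)
      by (intro permutations_of_setI) (simp_all add: insert_absorb)
    ultimately show ?thesis using b(3) by (simp add: arrangements_def)
  next
    case 2
    then obtain y z ys where b: "z \<in> A" "a < z" "y \<in> A" "z < y" "xs = a # y # ys"
      "set ys = A - {a, y}" "distinct ys" "hd ys = z"
      "outcome w ys" by (auto simp: arrangements_def permutations_of_set_def)
    have "length ys = Suc m" using b assms distinct_card[of ys] by (simp add: card_Diff_subset)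
    then obtain zs where [simp]: "ys = z # zs" using b by (auto simp: length_Suc_conv)
    have d: "distinct xs" "set xs = A" using b(1-7) assms(2) by auto
    have "outcome w xs"
      using outcome_ascent[of a y z zs w] d(1) b(2,4,5,9) \<open>ys = z # zs\<close> by (metis less_trans)
    moreover have "xs \<in> permutations_of_set A" using d by auto
    ultimately show ?thesis using b(5) by (simp add: arrangements_def)
  next
    case 3
    then show ?thesis by (auto simp: arrangements_def outcome_Cons)
  qed
qed

lemma card_increasing_triple:
  assumes "finite A" "a \<in> A" "card A = Suc (Suc (Suc m))"
  shows "card {xs. w \<and> m = 0 \<and> (\<exists>y z. xs = [a, y, z] \<and> a < y \<and> y < z \<and> A = {a, y, z})}
       = of_bool (w \<and> m = 0 \<and> rank_in A a = 0)" (is "card ?E = _")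
proof (cases "w \<and> m = 0 \<and> rank_in A a = 0")
  case True
  then have above: "\<And>x. x \<in> A \<Longrightarrow> x \<noteq> a \<Longrightarrow> a < x"
    using assms by (auto simp: rank_in_def card_eq_0_iff)
  have "card (A - {a}) = 2" using assms True by simp
  then obtain p q where pq: "A - {a} = {p, q}" "p < q"
    by (metis card_2_iff insert_commute linorder_neqE_nat)
  then have A: "A = {a, p, q}" using assms by auto
  have "a < p" "a < q" using above pq by blast+
  have "?E = {[a, p, q]}"
    using True pq A \<open>a < p\<close> \<open>a < q\<close> by (auto simp: doubleton_eq_iff insert_eq_iff)
  with True show ?thesis by simp
next
  case False
  have "?E = {}"
  proof -
    have False if "w" "m = 0" "a < y" "y < z" "A = {a, y, z}" for y z
    proof -
      have "{x \<in> A. x < a} = {}" using that by auto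
      with that False show False unfolding rank_in_def by (metis card.empty)
    qed
    then show ?thesis by blast
  qed
  with False show ?thesis by (simp only: card.empty of_bool_eq simp_thms)
qed

text \<open>Since the count is claimed for arrangements of an arbitrary finite set, removing one or two
  entries leads to another instance of the claim, and no standardization is needed. Only the
  ranks have to be tracked: removing a smaller entry lowers the rank by one, removing a larger
  one preserves it.\<close>
lemma card_arrangements:
  assumes "finite A" "a \<in> A"
  shows "card (arrangements w A a) = arrangement_count w (card A) (rank_in A a)"
  using assms
proof (induction "card A" arbitrary: A a rule: less_induct)
  case less
  consider "card A = 1" | "card A = 2" | m where "card A = Suc (Suc (Suc m))"
    using less.prems
    by (metis One_nat_def Suc_1 card_gt_0_iff empty_iff less_irrefl not0_implies_Suc)
  then show ?case
  proof cases
    case 1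
    then have "A = {a}" using less.prems by (auto simp: card_1_singleton_iff)
    then have "arrangements w A a = {xs \<in> {[a]}. outcome w xs}" by (auto simp: arrangements_def)
    also have "\<dots> = (if w then {} else {[a]})" using outcome_short(1)[of w a] by auto
    finally show ?thesis using 1 by simp
  next
    case 2
    then obtain c where c: "A = {a, c}" "a \<noteq> c" using less.prems by (auto simp: card_2_iff)
    then have perms: "permutations_of_set A = {[a, c], [c, a]}"
      using permutations_of_set_doubleton[OF c(2)] by simp
    have "[a, c] \<in> arrangements w A a \<longleftrightarrow> \<not> w"
      by (simp add: arrangements_def perms outcome_short)
    moreover have "arrangements w A a \<subseteq> {[a, c]}"
    proof
      fix xs assume "xs \<in> arrangements w A a"
      then have "xs = [a, c] \<or> xs = [c, a]" "hd xs = a" by (simp_all add: arrangements_def perms)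
      then show "xs \<in> {[a, c]}" using c(2) by (metis list.sel(1) singletonI)
    qed
    ultimately have "arrangements w A a = (if w then {} else {[a, c]})"
      by (cases w) (simp_all, blast+)
    then show ?thesis using 2 by (simp add: numeral_2_eq_2)
  next
    case 3
    let ?R1 = "\<Union>b\<in>{b \<in> A. b < a}. (#) a ` arrangements w (A - {a}) b"
    let ?S = "SIGMA z:{z \<in> A. a < z}. {y \<in> A. z < y}"
    let ?R2 = "\<Union>(z, y)\<in>?S. (\<lambda>zs. a # y # zs) ` arrangements w (A - {a, y}) z"
    let ?R3 = "{xs. w \<and> m = 0 \<and> (\<exists>y z. xs = [a, y, z] \<and> a < y \<and> y < z \<and> A = {a, y, z})}"
    have fin: "finite ?R1" "finite ?R2" using less.prems by auto
    have d12: "?R1 \<inter> ?R2 = {}"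
    proof -
      have False if "b < a" "a # ys \<in> (\<lambda>zs. a # y # zs) ` arrangements w (A - {a, y}) z" "a < z" "z < y"
        "ys \<in> arrangements w (A - {a}) b" for b ys y z
        using that by (auto simp: arrangements_def)
      then show ?thesis by fastforce
    qed
    have d3: "(?R1 \<union> ?R2) \<inter> ?R3 = {}" by (auto simp: arrangements_def)
    have fin3: "finite ?R3"
    proof (rule finite_subset)
      show "?R3 \<subseteq> permutations_of_set A" by auto
    qed simp
    have "card (arrangements w A a) = card (?R1 \<union> ?R2) + card ?R3"
      unfolding arrangements_decompose[OF less.prems 3] using fin fin3 d3 by (intro card_Un_disjoint) auto
    also have "card (?R1 \<union> ?R2) = card ?R1 + card ?R2"
      using fin d12 by (intro card_Un_disjoint) auto
    also have "card ?R1 = (\<Sum>b\<in>{b \<in> A. b < a}. card ((#) a ` arrangements w (A - {a}) b))"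
      using less.prems by (intro card_UN_disjoint) (auto simp: arrangements_def)
    also have "\<dots> = (\<Sum>b\<in>{b \<in> A. b < a}. arrangement_count w (Suc (Suc m)) (rank_in A b))"
    proof (rule sum.cong[OF refl])
      fix b assume b: "b \<in> {b \<in> A. b < a}"
      then have "rank_in (A - {a}) b = rank_in A b" by (auto simp: rank_in_def intro: arg_cong[where f = card])
      moreover have "card (arrangements w (A - {a}) b) = arrangement_count w (card (A - {a})) (rank_in (A - {a}) b)"
        by (rule less.hyps) (use b less.prems 3 in auto)
      ultimately show "card ((#) a ` arrangements w (A - {a}) b) = arrangement_count w (Suc (Suc m)) (rank_in A b)"
        using 3 less.prems by (simp add: card_image)
    qed
    also have "\<dots> = (\<Sum>j<rank_in A a. arrangement_count w (Suc (Suc m)) j)"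
      by (rule sum.reindex_bij_betw[OF bij_betw_rank_in_below[OF less.prems]])
    also have "card ?R2 = (\<Sum>(z, y)\<in>?S. card ((\<lambda>zs. a # y # zs) ` arrangements w (A - {a, y}) z))"
      unfolding case_prod_unfold using less.prems
      by (subst card_UN_disjoint) (auto simp: arrangements_def)
    also have "\<dots> = (\<Sum>z\<in>{z \<in> A. a < z}. \<Sum>y\<in>{y \<in> A. z < y}. card (arrangements w (A - {a, y}) z))"
      using less.prems by (subst sum.Sigma) (auto simp: card_image inj_on_def)
    also have "\<dots> = (\<Sum>z\<in>{z \<in> A. a < z}. (m + 2 - rank_in A z) * arrangement_count w (Suc m) (rank_in A z - 1))"
    proof (rule sum.cong[OF refl])
      fix z assume z: "z \<in> {z \<in> A. a < z}"
      have "card (arrangements w (A - {a, y}) z) = arrangement_count w (Suc m) (rank_in A z - 1)" if "y \<in> {y \<in> A. z < y}" for y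
      proof -
        have "{x \<in> A - {a, y}. x < z} = {x \<in> A. x < z} - {a}" using that by auto
        then have "rank_in (A - {a, y}) z = rank_in A z - 1"
          using z less.prems by (simp add: rank_in_def)
        moreover have ca: "card (A - {a, y}) = Suc m"
          using z that less.prems 3 by (subst card_Diff_subset) auto
        moreover have "card (arrangements w (A - {a, y}) z) = arrangement_count w (card (A - {a, y})) (rank_in (A - {a, y}) z)"
          by (rule less.hyps) (use z that less.prems 3 ca in auto)
        ultimately show ?thesis by simp
      qed
      moreover have "card {y \<in> A. z < y} = m + 2 - rank_in A z"
        using rank_in_split[of A z] z less.prems 3 by simp
      ultimately show "(\<Sum>y\<in>{y \<in> A. z < y}. card (arrangements w (A - {a, y}) z))
        = (m + 2 - rank_in A z) * arrangement_count w (Suc m) (rank_in A z - 1)" by simp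
    qed
    also have "\<dots> = (\<Sum>k\<in>{rank_in A a<..<card A}. (m + 2 - k) * arrangement_count w (Suc m) (k - 1))"
      by (rule sum.reindex_bij_betw[OF bij_betw_rank_in_above[OF less.prems]])
    also have "\<dots> = (\<Sum>j\<in>{rank_in A a..<Suc (Suc m)}. (m + 1 - j) * arrangement_count w (Suc m) j)"
      by (rule sum.reindex_bij_witness[of _ Suc "\<lambda>k. k - 1"]) (use 3 in auto)
    also have "\<dots> = (\<Sum>j=rank_in A a..m. (m + 1 - j) * arrangement_count w (Suc m) j)"
      by (rule sum.mono_neutral_right) auto
    also note card_increasing_triple[OF less.prems 3]
    finally show ?thesis using 3 by simp
  qed
qed

lemma card_outcome:
  assumes "0 < n"
  shows "card {xs \<in> permutations_of_set {1..n}. outcome w xs} = (\<Sum>i<n. arrangement_count w n i)"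
proof -
  have "{xs \<in> permutations_of_set {1..n}. outcome w xs} = (\<Union>a\<in>{1..n}. arrangements w {1..n} a)"
  proof -
    have "hd xs \<in> {1..n}" if "xs \<in> permutations_of_set {1..n}" for xs
      using that assms permutations_of_setD(1)[OF that] by (cases xs) auto
    then show ?thesis by (auto simp: arrangements_def)
  qed
  also have "card \<dots> = (\<Sum>a=1..n. card (arrangements w {1..n} a))"
    by (rule card_UN_disjoint) (auto simp: arrangements_def)
  also have "\<dots> = (\<Sum>a=1..n. arrangement_count w n (a - 1))"
  proof (rule sum.cong[OF refl])
    fix a assume "a \<in> {1..n}"
    then have "{x \<in> {1..n}. x < a} = {1..<a}" by auto
    then show "card (arrangements w {1..n} a) = arrangement_count w n (a - 1)"
      using \<open>a \<in> {1..n}\<close> by (simp add: card_arrangements rank_in_def)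
  qed
  also have "\<dots> = (\<Sum>i<n. arrangement_count w n i)"
    by (rule sum.reindex_bij_witness[of _ Suc "\<lambda>k. k - 1"]) auto
  finally show ?thesis .
qed

section \<open>Relative orders of exchangeable variables\<close>

definition order_type :: "nat \<Rightarrow> (nat \<Rightarrow> 'a::linorder) \<Rightarrow> nat list \<Rightarrow> bool" where
  "order_type n x \<pi> \<longleftrightarrow> (\<forall>i<n. \<forall>j<n. x i < x j \<longleftrightarrow> \<pi> ! i < \<pi> ! j)"

text \<open>The entry at position \<open>i\<close> is the number of entries that do not exceed it, which
  comparisons alone determine. The same formula produces the permutation in
  \<open>order_type_exists\<close>.\<close>
lemma order_type_unique:
  assumes "\<pi> \<in> permutations_of_set {1..n}" "\<pi>' \<in> permutations_of_set {1..n}"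
    and "order_type n x \<pi>" "order_type n x \<pi>'"
  shows "\<pi> = \<pi>'"
proof -
  have entry: "\<rho> ! i = card {j \<in> {..<n}. \<not> x i < x j}"
    if \<rho>: "\<rho> \<in> permutations_of_set {1..n}" "order_type n x \<rho>" and i: "i < n" for \<rho> i
  proof -
    have len: "length \<rho> = n" using \<rho>(1) by (simp add: length_finite_permutations_of_set)
    have bij: "bij_betw ((!) \<rho>) {..<n} {1..n}"
      using \<rho>(1) len by (auto intro!: bij_betw_nth dest: permutations_of_setD)
    have "{j \<in> {..<n}. \<not> x i < x j} = {j \<in> {..<n}. \<rho> ! j \<le> \<rho> ! i}" (is "_ = ?B")
      using \<rho>(2) i by (auto simp: order_type_def)
    moreover have "card ?B = card ((!) \<rho> ` ?B)"
      by (rule card_image[symmetric], rule inj_on_subset[OF bij_betw_imp_inj_on[OF bij]]) auto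
    moreover have "(!) \<rho> ` ?B = {v \<in> {1..n}. v \<le> \<rho> ! i}"
      unfolding bij_betw_imp_surj_on[OF bij, symmetric] by auto
    moreover have "{v \<in> {1..n}. v \<le> \<rho> ! i} = {1..\<rho> ! i}"
      using bij_betw_apply[OF bij, of i] i by auto
    ultimately show ?thesis by simp
  qed
  show ?thesis
    by (rule nth_equalityI)
       (use entry assms in \<open>auto simp: length_finite_permutations_of_set\<close>)
qed

lemma order_type_exists:
  fixes x :: "nat \<Rightarrow> 'a::linorder"
  assumes "inj_on x {..<n}"
  obtains \<pi> where "\<pi> \<in> permutations_of_set {1..n}" "order_type n x \<pi>"
proof
  let ?r = "\<lambda>i. card {j \<in> {..<n}. x j \<le> x i}"
  let ?\<pi> = "map ?r [0..<n]"
  have mono: "?r i < ?r j" if "j < n" "x i < x j" for i j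
  proof (rule psubset_card_mono)
    have "{k \<in> {..<n}. x k \<le> x i} \<subseteq> {k \<in> {..<n}. x k \<le> x j}"
      using that by (force intro: order_trans)
    moreover have "j \<in> {k \<in> {..<n}. x k \<le> x j}" "j \<notin> {k \<in> {..<n}. x k \<le> x i}"
      using that by simp_all
    ultimately show "{k \<in> {..<n}. x k \<le> x i} \<subset> {k \<in> {..<n}. x k \<le> x j}" by blast
  qed simp
  show "order_type n x ?\<pi>"
    unfolding order_type_def
  proof (intro allI impI)
    fix i j assume ij: "i < n" "j < n"
    have "?r j \<le> ?r i" if "x j \<le> x i"
      using that by (intro card_mono) (auto intro: order_trans)
    then show "x i < x j \<longleftrightarrow> ?\<pi> ! i < ?\<pi> ! j" using ij mono[of j i] by (auto simp: not_less[symmetric])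
  qed
  have inj: "inj_on ?r {..<n}"
  proof (rule inj_onI)
    fix i j assume ij: "i \<in> {..<n}" "j \<in> {..<n}" "?r i = ?r j"
    then have "\<not> x i < x j" "\<not> x j < x i" using mono[of j i] mono[of i j] by auto
    then show "i = j" using assms ij by (auto dest: inj_onD)
  qed
  have "?r ` {..<n} = {1..n}"
  proof (rule card_subset_eq)
    show "?r ` {..<n} \<subseteq> {1..n}"
    proof clarify
      fix i assume "i < n"
      then have "0 < ?r i" by (subst card_gt_0_iff) auto
      moreover have "?r i \<le> card {..<n}" by (intro card_mono) auto
      ultimately show "?r i \<in> {1..n}" by simp
    qed
    show "card (?r ` {..<n}) = card {1..n}" using inj by (simp add: card_image)
  qed simp
  with inj show "?\<pi> \<in> permutations_of_set {1..n}"
    by (intro permutations_of_setI) (auto simp: distinct_map atLeast0LessThan)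
qed

context prob_space
begin

text \<open>By independence the pair \<open>(X i, X j)\<close> has a product distribution, and a continuous
  distribution function has no atoms, so every vertical section of the diagonal is a null set.\<close>
lemma AE_neq:
  fixes X :: "'i \<Rightarrow> 'a \<Rightarrow> real"
  assumes indep: "indep_vars (\<lambda>_. borel) X UNIV"
    and cont: "continuous_on UNIV (cdf (distr M borel (X j)))"
    and "i \<noteq> j"
  shows "AE \<omega> in M. X i \<omega> \<noteq> X j \<omega>"
proof -
  have rv[measurable]: "X k \<in> borel_measurable M" for k
    using indep by (auto simp: indep_vars_def)
  have "indep_var borel ((\<lambda>f. f i) \<circ> (\<lambda>\<omega>. restrict (\<lambda>k. X k \<omega>) {i}))
          borel ((\<lambda>f. f j) \<circ> (\<lambda>\<omega>. restrict (\<lambda>k. X k \<omega>) {j}))"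
    using \<open>i \<noteq> j\<close> by (intro indep_var_compose[OF indep_var_restrict[OF indep]]) auto
  then have ind: "indep_var borel (X i) borel (X j)" by (simp add: comp_def)
  define D where "D k = distr M borel (X k)" for k
  interpret Di: prob_space "D i" unfolding D_def by (rule prob_space_distr) simp
  interpret Dj: real_distribution "D j"
    unfolding D_def by (rule real_distribution_distr) simp
  have null: "measure (D j) {y} = 0" for y
    using cont Dj.isCont_cdf by (simp add: continuous_on_eq_continuous_at D_def)
  have [measurable_cong]: "sets (D i) = sets borel" "sets (D j) = sets borel" by (simp_all add: D_def)
  interpret P: pair_sigma_finite "D i" "D j" ..
  have "AE y in D j. x \<noteq> y" for x
    by (rule AE_I'[of "{x}"]) (auto simp: null_sets_def Dj.emeasure_eq_measure null)
  then have "AE p in D i \<Otimes>\<^sub>M D j. fst p \<noteq> snd p"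
  proof (intro P.AE_pair_measure)
    show "{p \<in> space (D i \<Otimes>\<^sub>M D j). fst p \<noteq> snd p} \<in> sets (D i \<Otimes>\<^sub>M D j)" by measurable
  qed simp
  moreover have "D i \<Otimes>\<^sub>M D j = distr M (borel \<Otimes>\<^sub>M borel) (\<lambda>\<omega>. (X i \<omega>, X j \<omega>))"
    using ind by (simp add: indep_var_distribution_eq D_def)
  ultimately have "AE p in distr M (borel \<Otimes>\<^sub>M borel) (\<lambda>\<omega>. (X i \<omega>, X j \<omega>)). fst p \<noteq> snd p"
    by (simp only:)
  from AE_distrD[OF _ this] show ?thesis by simp
qed

text \<open>The joint law of the first \<open>n\<close> variables is a power of one law, which is invariant
  under permutations of the coordinates.\<close>
lemma exchangeable:
  fixes X :: "nat \<Rightarrow> 'a \<Rightarrow> real"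
  assumes indep: "indep_vars (\<lambda>_. borel) X UNIV"
    and ident: "\<And>m n. distr M borel (X m) = distr M borel (X n)"
    and g: "g ` {..<n} = {..<n}"
    and [measurable]: "Measurable.pred (PiM {..<n} (\<lambda>_. borel)) R"
  shows "prob {\<omega> \<in> space M. R (\<lambda>i\<in>{..<n}. X (g i) \<omega>)} = prob {\<omega> \<in> space M. R (\<lambda>i\<in>{..<n}. X i \<omega>)}"
proof (cases "n = 0")
  case True
  then show ?thesis by (simp add: restrict_def)
next
  case False
  let ?I = "{..<n}" and ?B = "PiM {..<n} (\<lambda>_. borel :: real measure)"
  have rv[measurable]: "X k \<in> borel_measurable M" for k
    using indep by (auto simp: indep_vars_def)
  define D where "D = distr M borel (X 0)"
  have D: "distr M borel (X k) = D" for k unfolding D_def by (rule ident)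
  have sets_D[measurable_cong]: "sets (PiM ?I (\<lambda>_. D)) = sets ?B"
    by (intro sets_PiM_cong) (simp_all add: D_def)
  interpret D: prob_space D unfolding D_def by (rule prob_space_distr) simp
  have "indep_vars (\<lambda>_. borel) X ?I" by (rule indep_vars_subset[OF indep]) simp
  then have joint: "distr M ?B (\<lambda>\<omega>. \<lambda>i\<in>?I. X i \<omega>) = PiM ?I (\<lambda>_. D)"
    using indep_vars_iff_distr_eq_PiM[where I = ?I and M' = "\<lambda>_. borel" and X = X] False by (simp add: D lessThan_empty_iff)
  have inj: "inj_on g ?I" by (rule eq_card_imp_inj_on) (simp_all add: g)
  have gI: "g i < n" if "i < n" for i using g that by blast
  have [measurable]: "(\<lambda>w. \<lambda>i\<in>?I. w (g i)) \<in> ?B \<rightarrow>\<^sub>M ?B"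
    using gI by (intro measurable_restrict measurable_component_singleton) auto
  have "distr (PiM ?I (\<lambda>_. D)) (PiM ?I (\<lambda>_. D)) (\<lambda>w. \<lambda>i\<in>?I. w (g i)) = PiM ?I (\<lambda>_. D)"
    using distr_PiM_reindex[of ?I "\<lambda>_. D" g ?I] inj g D.prob_space_axioms by auto
  then have re: "distr (PiM ?I (\<lambda>_. D)) ?B (\<lambda>w. \<lambda>i\<in>?I. w (g i)) = PiM ?I (\<lambda>_. D)"
    by (subst (asm) distr_cong[OF refl sets_D refl]) simp
  have "distr M ?B (\<lambda>\<omega>. \<lambda>i\<in>?I. X (g i) \<omega>)
      = distr (distr M ?B (\<lambda>\<omega>. \<lambda>i\<in>?I. X i \<omega>)) ?B (\<lambda>w. \<lambda>i\<in>?I. w (g i))"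
    by (subst distr_distr) (auto intro!: distr_cong simp: gI)
  also have "\<dots> = distr M ?B (\<lambda>\<omega>. \<lambda>i\<in>?I. X i \<omega>)"
    unfolding joint re ..
  finally have eq: "distr M ?B (\<lambda>\<omega>. \<lambda>i\<in>?I. X (g i) \<omega>) = distr M ?B (\<lambda>\<omega>. \<lambda>i\<in>?I. X i \<omega>)" .
  have m: "prob {\<omega> \<in> space M. R (\<lambda>i\<in>?I. X (h i) \<omega>)}
      = measure (distr M ?B (\<lambda>\<omega>. \<lambda>i\<in>?I. X (h i) \<omega>)) {w \<in> space ?B. R w}" for h
    by (subst measure_distr) (auto intro!: arg_cong[where f = prob] simp: space_PiM)
  show ?thesis using m[of g] m[of "\<lambda>i. i"] eq by simp
qed

text \<open>By exchangeability all \<open>n!\<close> order types have the same probability, and almost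
  surely exactly one of them occurs. Hence the probability of an event that depends only on the
  order type is a proportion of permutations.\<close>
lemma prob_order_type:
  fixes X :: "nat \<Rightarrow> 'a \<Rightarrow> real"
  assumes indep: "indep_vars (\<lambda>_. borel) X UNIV"
    and ident: "\<And>m n. distr M borel (X m) = distr M borel (X n)"
    and cont: "\<And>n. continuous_on UNIV (cdf (distr M borel (X n)))"
    and meas: "{\<omega> \<in> space M. Q (\<lambda>i. X i \<omega>)} \<in> events"
    and Q: "\<And>x \<pi>. \<pi> \<in> permutations_of_set {1..n} \<Longrightarrow> order_type n x \<pi> \<Longrightarrow> Q x \<longleftrightarrow> R \<pi>"
  shows "prob {\<omega> \<in> space M. Q (\<lambda>i. X i \<omega>)}
       = real (card {\<pi> \<in> permutations_of_set {1..n}. R \<pi>}) / fact n"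
proof -
  let ?S = "permutations_of_set {1..n}"
  have rv[measurable]: "X k \<in> borel_measurable M" for k
    using indep by (auto simp: indep_vars_def)
  define E where "E \<pi> = {\<omega> \<in> space M. order_type n (\<lambda>i. X i \<omega>) \<pi>}" for \<pi>
  have E[measurable]: "E \<pi> \<in> events" for \<pi>
    unfolding E_def order_type_def by measurable
  have disj: "disjoint_family_on E ?S"
    unfolding disjoint_family_on_def E_def using order_type_unique by fast
  have union: "prob (\<Union>\<pi>\<in>T. E \<pi>) = (\<Sum>\<pi>\<in>T. prob (E \<pi>))" if "T \<subseteq> ?S" for T
    using that disj finite_subset[OF that]
    by (intro finite_measure_finite_Union) (auto simp: disjoint_family_on_def)
  have "AE \<omega> in M. \<forall>i j. i \<noteq> j \<longrightarrow> X i \<omega> \<noteq> X j \<omega>"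
    unfolding AE_all_countable using AE_neq[OF indep cont] by simp
  then have ae: "AE \<omega> in M. \<exists>\<pi>\<in>?S. \<omega> \<in> E \<pi>"
  proof (rule AE_mp, intro AE_I2 impI)
    fix \<omega> assume "\<omega> \<in> space M" and ne: "\<forall>i j. i \<noteq> j \<longrightarrow> X i \<omega> \<noteq> X j \<omega>"
    from ne have "inj_on (\<lambda>i. X i \<omega>) {..<n}" by (auto intro: inj_onI)
    from order_type_exists[OF this] show "\<exists>\<pi>\<in>?S. \<omega> \<in> E \<pi>"
      using \<open>\<omega> \<in> space M\<close> by (auto simp: E_def)
  qed
  have same: "prob (E \<pi>) = prob (E [1..<Suc n])" if \<pi>: "\<pi> \<in> ?S" for \<pi>
  proof -
    define g where "g i = \<pi> ! i - 1" for i
    have len: "length \<pi> = n" using \<pi> by (simp add: length_finite_permutations_of_set)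
    have "(!) \<pi> ` {..<n} = {1..n}"
      using permutations_of_setD(1)[OF \<pi>] len by (metis lessThan_atLeast0 list.set_map map_nth set_upt)
    then have img: "{1..n} = (!) \<pi> ` {..<n}" ..
    have "g ` {..<n} = (\<lambda>k. k - 1) ` {1..n}"
      unfolding img by (simp add: g_def image_image)
    also have "\<dots> = {..<n}"
      by (auto simp: image_iff intro!: bexI[of _ "Suc _"])
    finally have g: "g ` {..<n} = {..<n}" .
    have pos: "\<pi> ! i = Suc (g i)" if "i < n" for i
    proof -
      have "\<pi> ! i \<in> {1..n}" unfolding img using that by (intro imageI) simp
      then show ?thesis by (simp add: g_def)
    qed
    \<comment> \<open>Permuting the variables by \<open>g\<close>, which is \<open>\<pi>\<close> shifted to start at \<open>0\<close>,
      turns the event of order type \<open>\<pi>\<close> into the event that the variables are increasing.\<close>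
    let ?R = "\<lambda>w :: nat \<Rightarrow> real. \<forall>i\<in>{..<n}. \<forall>j\<in>{..<n}. w i < w j \<longleftrightarrow> \<pi> ! i < \<pi> ! j"
    have "prob {\<omega> \<in> space M. ?R (\<lambda>i\<in>{..<n}. X (g i) \<omega>)} = prob {\<omega> \<in> space M. ?R (\<lambda>i\<in>{..<n}. X i \<omega>)}"
      by (rule exchangeable[OF indep ident g]) measurable
    also have "{\<omega> \<in> space M. ?R (\<lambda>i\<in>{..<n}. X i \<omega>)} = E \<pi>"
      by (auto simp: E_def order_type_def)
    also have "{\<omega> \<in> space M. ?R (\<lambda>i\<in>{..<n}. X (g i) \<omega>)} = E [1..<Suc n]"
    proof -
      have "?R (\<lambda>i\<in>{..<n}. x (g i)) \<longleftrightarrow> (\<forall>k\<in>{..<n}. \<forall>l\<in>{..<n}. x k < x l \<longleftrightarrow> k < l)"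
        for x :: "nat \<Rightarrow> real"
      proof -
        have "?R (\<lambda>i\<in>{..<n}. x (g i)) \<longleftrightarrow> (\<forall>i\<in>{..<n}. \<forall>j\<in>{..<n}. x (g i) < x (g j) \<longleftrightarrow> g i < g j)"
          by (simp add: pos)
        also have "\<dots> \<longleftrightarrow> (\<forall>k\<in>g ` {..<n}. \<forall>l\<in>g ` {..<n}. x k < x l \<longleftrightarrow> k < l)" by blast
        finally show ?thesis unfolding g .
      qed
      moreover have "order_type n x [1..<Suc n] \<longleftrightarrow> (\<forall>k\<in>{..<n}. \<forall>l\<in>{..<n}. x k < x l \<longleftrightarrow> k < l)"
        for x :: "nat \<Rightarrow> real"
        by (auto simp: order_type_def simp del: upt_Suc)
      ultimately have "?R (\<lambda>i\<in>{..<n}. X (g i) \<omega>) \<longleftrightarrow> order_type n (\<lambda>i. X i \<omega>) [1..<Suc n]" for \<omega>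
        by (simp only:)
      then show ?thesis unfolding E_def by (intro Collect_cong) (simp only:)
    qed
    finally show ?thesis by simp
  qed
  have "prob (\<Union>\<pi>\<in>?S. E \<pi>) = 1"
    using ae by (subst prob_eq_1) (auto intro!: sets.finite_UN)
  moreover have "prob (\<Union>\<pi>\<in>?S. E \<pi>) = fact n * prob (E [1..<Suc n])"
    unfolding union[OF order_refl] by (simp add: same del: upt_Suc)
  ultimately have p: "prob (E [1..<Suc n]) = 1 / fact n" by (simp add: field_simps)
  have "prob {\<omega> \<in> space M. Q (\<lambda>i. X i \<omega>)} = prob (\<Union>\<pi>\<in>{\<pi> \<in> ?S. R \<pi>}. E \<pi>)"
  proof (rule finite_measure_eq_AE[OF _ meas])
    show "AE \<omega> in M. \<omega> \<in> {\<omega> \<in> space M. Q (\<lambda>i. X i \<omega>)} \<longleftrightarrow> \<omega> \<in> (\<Union>\<pi>\<in>{\<pi> \<in> ?S. R \<pi>}. E \<pi>)"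
      using ae
    proof (rule AE_mp, intro AE_I2 impI)
      fix \<omega> assume "\<omega> \<in> space M" "\<exists>\<pi>\<in>?S. \<omega> \<in> E \<pi>"
      then obtain \<pi> where \<pi>: "\<pi> \<in> ?S" "order_type n (\<lambda>i. X i \<omega>) \<pi>" by (auto simp: E_def)
      have "\<omega> \<in> (\<Union>\<rho>\<in>{\<rho> \<in> ?S. R \<rho>}. E \<rho>) \<longleftrightarrow> (\<exists>\<rho>\<in>?S. R \<rho> \<and> order_type n (\<lambda>i. X i \<omega>) \<rho>)"
        using \<open>\<omega> \<in> space M\<close> unfolding E_def by blast
      also have "\<dots> \<longleftrightarrow> R \<pi>" using \<pi> order_type_unique by blast
      also have "\<dots> \<longleftrightarrow> \<omega> \<in> {\<omega> \<in> space M. Q (\<lambda>i. X i \<omega>)}"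
        using Q[OF \<pi>] \<open>\<omega> \<in> space M\<close> by simp
      finally show "\<omega> \<in> {\<omega> \<in> space M. Q (\<lambda>i. X i \<omega>)} \<longleftrightarrow> \<omega> \<in> (\<Union>\<pi>\<in>{\<pi> \<in> ?S. R \<pi>}. E \<pi>)"
        by (rule sym)
    qed
  qed (auto intro!: sets.finite_UN)
  also have "\<dots> = (\<Sum>\<pi>\<in>{\<pi> \<in> ?S. R \<pi>}. prob (E \<pi>))"
    by (rule union) auto
  also have "\<dots> = (\<Sum>\<pi>\<in>{\<pi> \<in> ?S. R \<pi>}. 1 / fact n)"
  proof (rule sum.cong[OF refl])
    fix \<pi> assume "\<pi> \<in> {\<pi> \<in> ?S. R \<pi>}"
    then have "\<pi> \<in> ?S" by simp
    from same[OF this] show "prob (E \<pi>) = 1 / fact n" unfolding p .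
  qed
  finally show ?thesis by simp
qed

end

section \<open>Evaluating the recursion\<close>

text \<open>With lists for the rows of \<open>arrangement_count\<close>, the two sums in the recursion
  become running sums: one of prefixes, and one of suffixes weighted by the distance to the end.
  Every new entry then costs a constant number of operations.\<close>
primrec prefix_sums :: "int \<Rightarrow> int list \<Rightarrow> int list" where
  "prefix_sums s [] = [s]"
| "prefix_sums s (x # xs) = s # prefix_sums (s + x) xs"

text \<open>In \<open>weighted_tails\<close> the first component carries the next weight. The two trailing
  zeros make the list as long as the row that is being computed: for the largest and the second
  largest first entry the sum is empty.\<close>
fun cons_weighted :: "int \<Rightarrow> int \<times> int list \<Rightarrow> int \<times> int list" where
  "cons_weighted x (l, s) = (l + 1, (hd s + l * x) # s)"

primrec weighted_tails :: "int list \<Rightarrow> int \<times> int list" where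
  "weighted_tails [] = (1, [0, 0])"
| "weighted_tails (x # xs) = cons_weighted x (weighted_tails xs)"

lemma cons_weighted_eq: "cons_weighted x p = (fst p + 1, (hd (snd p) + fst p * x) # snd p)"
  by (cases p) simp

definition count_row :: "bool \<Rightarrow> nat \<Rightarrow> int list" where
  "count_row w n = map (\<lambda>i. int (arrangement_count w n i)) [0..<n]"

lemma length_prefix_sums [simp]: "length (prefix_sums s xs) = Suc (length xs)"
  by (induction xs arbitrary: s) auto

lemma nth_prefix_sums:
  "i \<le> length xs \<Longrightarrow> prefix_sums s xs ! i = s + (\<Sum>j<i. xs ! j)"
proof (induction xs arbitrary: s i)
  case (Cons x xs)
  then show ?case
    by (cases i) (auto simp: sum.lessThan_Suc_shift simp del: sum.lessThan_Suc)
qed simp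

lemma fst_weighted_tails: "fst (weighted_tails xs) = int (length xs) + 1"
  by (induction xs) (auto simp: cons_weighted_eq)

lemma length_weighted_tails: "length (snd (weighted_tails xs)) = length xs + 2"
  by (induction xs) (auto simp: cons_weighted_eq)

lemma nth_weighted_tails:
  "i < length xs + 2 \<Longrightarrow>
     snd (weighted_tails xs) ! i = (\<Sum>j=i..<length xs. (int (length xs) - int j) * xs ! j)"
proof (induction xs arbitrary: i)
  case Nil
  then show ?case by (auto simp: less_Suc_eq numeral_2_eq_2)
next
  case (Cons x xs)
  show ?case
  proof (cases i)
    case 0
    have "hd (snd (weighted_tails xs)) = snd (weighted_tails xs) ! 0"
      using length_weighted_tails[of xs] by (intro hd_conv_nth) auto
    then show ?thesis
      using Cons.IH[of 0]
      by (simp add: 0 cons_weighted_eq fst_weighted_tails sum.atLeast_Suc_lessThan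
            sum.shift_bounds_Suc_ivl del: sum.op_ivl_Suc)
  next
    case (Suc k)
    then show ?thesis
      using Cons.IH[of k] Cons.prems
      by (simp add: cons_weighted_eq sum.shift_bounds_Suc_ivl del: sum.op_ivl_Suc)
  qed
qed

lemma count_row_step:
  "count_row w (m + 4) = map2 (+) (prefix_sums 0 (count_row w (m + 3))) (snd (weighted_tails (count_row w (m + 2))))"
    (is "_ = ?r")
proof (rule nth_equalityI)
  show "length (count_row w (m + 4)) = length ?r"
    by (simp add: count_row_def length_weighted_tails)
next
  fix i assume "i < length (count_row w (m + 4))"
  then have i: "i < m + 4" by (simp add: count_row_def)
  have "count_row w (m + 4) ! i = int (arrangement_count w (Suc (Suc (Suc (Suc m)))) i)"
    using i by (simp add: count_row_def numeral_eq_Suc del: arrangement_count.simps upt_Suc)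
  also have "\<dots> = (\<Sum>j<i. int (arrangement_count w (m + 3) j))
      + (\<Sum>j=i..Suc m. int ((Suc m + 1 - j) * arrangement_count w (m + 2) j))"
    by (subst arrangement_count.simps) (simp add: numeral_eq_Suc del: arrangement_count.simps sum.cl_ivl_Suc)
  also have "(\<Sum>j<i. int (arrangement_count w (m + 3) j)) = (\<Sum>j<i. count_row w (m + 3) ! j)"
    using i by (intro sum.cong) (auto simp: count_row_def simp del: arrangement_count.simps upt_Suc)
  also have "\<dots> = prefix_sums 0 (count_row w (m + 3)) ! i"
    using i by (subst nth_prefix_sums) (auto simp: count_row_def)
  also have "(\<Sum>j=i..Suc m. int ((Suc m + 1 - j) * arrangement_count w (m + 2) j))
      = (\<Sum>j=i..<m + 2. (int (m + 2) - int j) * count_row w (m + 2) ! j)"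
    by (rule sum.cong) (auto simp: count_row_def of_nat_diff simp del: arrangement_count.simps upt_Suc)
  also have "\<dots> = snd (weighted_tails (count_row w (m + 2))) ! i"
    using i by (subst nth_weighted_tails) (simp_all add: count_row_def del: upt_Suc)
  finally show "count_row w (m + 4) ! i = ?r ! i"
    using i by (simp add: count_row_def length_weighted_tails)
qed

lemma sum_list_count_row: "sum_list (count_row w n) = int (\<Sum>i<n. arrangement_count w n i)"
  by (simp add: count_row_def interv_sum_list_conv_sum_set_nat atLeast0LessThan del: arrangement_count.simps)

text \<open>The new row is needed twice in the next state. As an argument of \<open>push\<close> it is fully
  evaluated before it is duplicated.\<close>
definition push :: "int \<Rightarrow> int list \<Rightarrow> int \<Rightarrow> int list \<Rightarrow> int \<times> int list \<times> int list \<times> int" where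
  "push n r s r' = (n, r, r', n * s + sum_list r')"

fun table_step :: "int \<times> int list \<times> int list \<times> int \<Rightarrow> int \<times> int list \<times> int list \<times> int" where
  "table_step (n, r, r', s) = push (n + 1) r' s (map2 (+) (prefix_sums 0 r') (snd (weighted_tails r)))"

text \<open>The state after \<open>m\<close> steps is the index \<open>n = m + 3\<close>, the rows
  \<open>n - 1\<close> and \<open>n\<close>, and \<open>n!\<close> times the partial sum of the
  series, kept an integer by Horner's scheme.\<close>
primrec table :: "bool \<Rightarrow> nat \<Rightarrow> int \<times> int list \<times> int list \<times> int" where
  "table w 0 = (3, if w then ([0, 0], [1, 0, 0], 1) else ([1, 1], [1, 1, 2], 4))"
| "table w (Suc m) = table_step (table w m)"

lemma table:
  "\<exists>s. table w m = (int m + 3, count_row w (m + 2), count_row w (m + 3), s) \<and>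
     real_of_int s / fact (m + 3) = (\<Sum>n=3..m + 3. real (\<Sum>i<n. arrangement_count w n i) / fact n)"
proof (induction m)
  case 0
  show ?case
    by (cases w) (simp_all add: count_row_def numeral_eq_Suc)
next
  case (Suc m)
  then obtain s where s: "table w m = (int m + 3, count_row w (m + 2), count_row w (m + 3), s)"
    "real_of_int s / fact (m + 3) = (\<Sum>n=3..m + 3. real (\<Sum>i<n. arrangement_count w n i) / fact n)"
    by blast
  have f: "(fact (m + 4) :: real) = (real m + 4) * fact (m + 3)"
    using fact_Suc[of "m + 3", where ?'a = real] by (simp add: algebra_simps numeral_eq_Suc)
  have "real_of_int ((int m + 4) * s + sum_list (count_row w (m + 4))) / fact (m + 4)
      = real_of_int s / fact (m + 3) + real (\<Sum>i<m + 4. arrangement_count w (m + 4) i) / fact (m + 4)"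
    unfolding sum_list_count_row by (simp add: add_divide_distrib f del: arrangement_count.simps)
  also have "\<dots> = (\<Sum>n=3..m + 4. real (\<Sum>i<n. arrangement_count w n i) / fact n)"
    unfolding s(2) by (simp add: numeral_eq_Suc del: arrangement_count.simps)
  finally have "real_of_int ((int m + 4) * s + sum_list (count_row w (m + 4))) / fact (m + 4)
      = (\<Sum>n=3..m + 4. real (\<Sum>i<n. arrangement_count w n i) / fact n)" .
  moreover have "table w (Suc m)
      = (int m + 4, count_row w (m + 3), count_row w (m + 4), (int m + 4) * s + sum_list (count_row w (m + 4)))"
    unfolding count_row_step by (simp add: s(1) push_def)
  moreover have "Suc m + 2 = m + 3" "Suc m + 3 = m + 4" "int (Suc m) + 3 = int m + 4" by simp_all
  ultimately show ?case by (metis (no_types))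
qed

lemma table_numeral:
  "table w (numeral k) = table_step (table w (pred_numeral k))"
  "table w 1 = table_step (table w 0)"
  by (simp_all add: numeral_eq_Suc)

lemma fact_24: "fact 24 = (620448401733239439360000 :: int)"
  by (simp add: fact_numeral)

text \<open>The terms up to \<open>n = 24\<close> suffice: the probability that neither pattern appears
  among the first \<open>24\<close> entries is about \<open>0.0003\<close>, and the partial sum
  is about \<open>0.5502\<close>.\<close>
lemma table_values:
  "5495 * fact 24 < 10000 * snd (snd (snd (table True 21)))"
  "10000 * (snd (snd (snd (table True 21))) + sum_list (fst (snd (snd (table False 21))))) < 5505 * fact 24"
  by (simp_all only: table_numeral table.simps(1) table_step.simps push_def pred_numeral_simps
        BitM.simps if_True if_False prefix_sums.simps weighted_tails.simps cons_weighted.simps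
        list.map zip_Cons_Cons zip_Nil prod.case list.sel sum_list.Nil sum_list.Cons
        fst_conv snd_conv fact_24 add_0 add_0_right mult_zero_left mult_zero_right mult_1 mult_1_right
        arith_simps arith_special rel_simps numeral_One simp_thms)

section \<open>First occurrences of the two patterns\<close>

lemma card_triple: fixes a b c :: "'a::linorder"
  shows "card {y \<in> {a, b, c}. y \<le> v} = card ((if a \<le> v then {a} else {}) \<union> (if b \<le> v then {b} else {}) \<union> (if c \<le> v then {c} else {}))"
  by (rule arg_cong[where f = card]) auto

lemma st_triple:
  fixes a b c :: "'a::linorder"
  shows "st [a, b, c] = [1, 2, 3] \<longleftrightarrow> a < b \<and> b < c"
    and "st [a, b, c] = [2, 3, 1] \<longleftrightarrow> c < a \<and> a < b"
proof -
  have st: "st [a, b, c] = map (\<lambda>v. card {y \<in> {a, b, c}. y \<le> v}) [a, b, c]"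
    by (simp add: st_def)
  consider "a < b" "b < c" | "a < c" "c < b" | "b < a" "a < c" | "b < c" "c < a" | "c < a" "a < b" | "c < b" "b < a"
    | "a = b" | "b = c" | "a = c"
    by (metis linorder_neqE)
  then have "(st [a, b, c] = [1, 2, 3] \<longleftrightarrow> a < b \<and> b < c) \<and> (st [a, b, c] = [2, 3, 1] \<longleftrightarrow> c < a \<and> a < b)"
    unfolding st card_triple by cases auto
  then show "st [a, b, c] = [1, 2, 3] \<longleftrightarrow> a < b \<and> b < c" "st [a, b, c] = [2, 3, 1] \<longleftrightarrow> c < a \<and> a < b"
    by blast+
qed

lemma seq_occurs_at_triple:
  "seq_occurs_at [1, 2, 3] x i \<longleftrightarrow> x i < x (i + 1) \<and> x (i + 1) < x (i + 2)"
  "seq_occurs_at [2, 3, 1] x i \<longleftrightarrow> x (i + 2) < x i \<and> x i < x (i + 1)"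
proof -
  have "map x [i..<i + 3] = [x i, x (i + 1), x (i + 2)]"
    by (simp add: numeral_3_eq_3 upt_rec)
  then show "seq_occurs_at [1, 2, 3] x i \<longleftrightarrow> x i < x (i + 1) \<and> x (i + 1) < x (i + 2)"
    "seq_occurs_at [2, 3, 1] x i \<longleftrightarrow> x (i + 2) < x i \<and> x i < x (i + 1)"
    unfolding seq_occurs_at_def by (simp_all add: st_triple[simplified])
qed

lemma occurs_at_iff_seq_occurs_at:
  "occurs_at \<sigma> xs i \<longleftrightarrow> i + length \<sigma> \<le> length xs \<and> seq_occurs_at \<sigma> ((!) xs) i"
proof -
  have "take (length \<sigma>) (drop i xs) = map ((!) xs) [i..<i + length \<sigma>]" if "i + length \<sigma> \<le> length xs"
    using that by (intro nth_equalityI) auto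
  then show ?thesis by (auto simp: occurs_at_def seq_occurs_at_def)
qed

lemma occurs_at_triple:
  "occurs_at [1, 2, 3] xs i \<longleftrightarrow> i + 3 \<le> length xs \<and> xs ! i < xs ! (i + 1) \<and> xs ! (i + 1) < xs ! (i + 2)"
  "occurs_at [2, 3, 1] xs i \<longleftrightarrow> i + 3 \<le> length xs \<and> xs ! (i + 2) < xs ! i \<and> xs ! i < xs ! (i + 1)"
  unfolding occurs_at_iff_seq_occurs_at seq_occurs_at_triple by (simp_all add: numeral_3_eq_3)

lemma wins_add_3: "wins x (i + 3) \<longleftrightarrow> x i < x (i + 1) \<and> x (i + 1) < x (i + 2) \<and> pattern_free x i"
  by (simp add: wins_def numeral_eq_Suc)

text \<open>The initial position \<open>i\<close> of the final block avoids the truncated subtraction in the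
  definition.\<close>
lemma wins_iff: "wins x n \<longleftrightarrow> (\<exists>i. n = i + 3 \<and> x i < x (i + 1) \<and> x (i + 1) < x (i + 2) \<and> pattern_free x i)"
proof
  assume "wins x n"
  then have "n = (n - 3) + 3" by (simp add: wins_def)
  with \<open>wins x n\<close> show "\<exists>i. n = i + 3 \<and> x i < x (i + 1) \<and> x (i + 1) < x (i + 2) \<and> pattern_free x i"
    using wins_add_3[of x "n - 3"] by auto
qed (auto simp: wins_add_3[simplified])

text \<open>If \<open>123\<close> comes first, then the smallest position at which it starts is preceded by
  no start of \<open>231\<close> either, so the end of this block is a win. The converse uses
  that the two patterns cannot start at the same place.\<close>
lemma first_occ_less_iff: "first_occ [1, 2, 3] x < first_occ [2, 3, 1] x \<longleftrightarrow> (\<exists>n. wins x n)"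
proof
  assume less: "first_occ [1, 2, 3] x < first_occ [2, 3, 1] x"
  let ?P = "\<lambda>i. x i < x (i + 1) \<and> x (i + 1) < x (i + 2)"
  have "\<exists>i. ?P i"
  proof (rule ccontr)
    assume "\<not> (\<exists>i. ?P i)"
    then have "{i. ?P i} = {}" by blast
    then have "first_occ [1, 2, 3] x = \<infinity>"
      unfolding first_occ_def seq_occurs_at_triple by (simp only: image_empty Inf_empty top_enat_def)
    then show False using less by simp
  qed
  then obtain i where i: "?P i" and least: "\<And>j. j < i \<Longrightarrow> \<not> ?P j"
    using exists_least_iff[of ?P] by blast
  have "enat i \<le> first_occ [1, 2, 3] x"
    unfolding first_occ_def seq_occurs_at_triple using least by (intro Inf_greatest) (auto simp: not_less[symmetric])
  then have "enat i < first_occ [2, 3, 1] x" using less by (rule le_less_trans)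
  then have "\<not> (x (j + 2) < x j \<and> x j < x (j + 1))" if "j \<le> i" for j
    unfolding first_occ_def seq_occurs_at_triple using that
    by (auto dest!: less_INF_D[where i = j])
  with least have "pattern_free x i" unfolding pattern_free_def match_at_def by (meson less_imp_le)
  with i have "wins x (i + 3)" unfolding wins_add_3 by blast
  then show "\<exists>n. wins x n" ..
next
  assume "\<exists>n. wins x n"
  then obtain i where i: "x i < x (i + 1)" "x (i + 1) < x (i + 2)" "pattern_free x i"
    by (auto simp: wins_iff)
  have "first_occ [1, 2, 3] x \<le> enat i"
    unfolding first_occ_def seq_occurs_at_triple using i by (intro Inf_lower) auto
  also have "enat i < enat (i + 1)" by simp
  also have "enat (i + 1) \<le> first_occ [2, 3, 1] x"
    unfolding first_occ_def seq_occurs_at_triple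
  proof (intro INF_greatest)
    fix j assume j: "j \<in> {i. x (i + 2) < x i \<and> x i < x (i + 1)}"
    then have "\<not> j < i" using i(3) by (auto simp: pattern_free_def match_at_def)
    moreover have "j \<noteq> i" using i(1,2) j by auto
    ultimately show "enat (i + 1) \<le> enat j" by simp
  qed
  finally show "first_occ [1, 2, 3] x < first_occ [2, 3, 1] x" .
qed

lemma wins_unique: "wins x m \<Longrightarrow> wins x n \<Longrightarrow> m = n"
proof (induction m n rule: linorder_wlog)
  case (le m n)
  show ?case
  proof (rule ccontr)
    assume "m \<noteq> n"
    obtain k where "m = k + 3" "match_at x k" using le(2) by (auto simp: wins_iff match_at_def)
    have "k < n - 3" using \<open>m = k + 3\<close> \<open>m \<noteq> n\<close> le(1) by simp
    then show False using le(3) \<open>match_at x k\<close> by (auto simp: wins_def pattern_free_def)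
  qed
qed simp

text \<open>The pattern \<open>231\<close> cannot occur at the position of the final \<open>123\<close>, so
  only the blocks before it have to avoid both patterns.\<close>
lemma Av_end_eq:
  "Av_end n [1, 2, 3] {[1, 2, 3], [2, 3, 1]} = {\<pi> \<in> permutations_of_set {1..n}. outcome True \<pi>}"
proof -
  have "3 \<le> n \<and> occurs_at [1, 2, 3] \<pi> (n - 3) \<and>
      (\<forall>\<rho>\<in>{[1, 2, 3], [2, 3, 1]}. \<forall>i. occurs_at \<rho> \<pi> i \<longrightarrow> \<rho> = [1, 2, 3] \<and> i = n - 3)
    \<longleftrightarrow> outcome True \<pi>" if len: "length \<pi> = n" for \<pi> :: "nat list"
  proof (cases "3 \<le> n")
    case True
    then obtain k where n: "n = k + 3" by (metis add.commute le_Suc_ex)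
    have out: "outcome True \<pi> \<longleftrightarrow> \<pi> ! k < \<pi> ! (k + 1) \<and> \<pi> ! (k + 1) < \<pi> ! (k + 2) \<and> pattern_free ((!) \<pi>) k"
      unfolding outcome_def len n wins_add_3 by simp
    have occ: "occurs_at [1, 2, 3] \<pi> i \<or> occurs_at [2, 3, 1] \<pi> i \<longleftrightarrow> i \<le> k \<and> match_at ((!) \<pi>) i" for i
      unfolding occurs_at_triple match_at_def len n by auto
    have [simp]: "n - 3 = k" by (simp add: n)
    show ?thesis
    proof
      assume *: "3 \<le> n \<and> occurs_at [1, 2, 3] \<pi> (n - 3) \<and>
        (\<forall>\<rho>\<in>{[1, 2, 3], [2, 3, 1]}. \<forall>i. occurs_at \<rho> \<pi> i \<longrightarrow> \<rho> = [1, 2, 3] \<and> i = n - 3)"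
      have "\<not> match_at ((!) \<pi>) i" if "i < k" for i
      proof
        assume "match_at ((!) \<pi>) i"
        then have "occurs_at [1, 2, 3] \<pi> i \<or> occurs_at [2, 3, 1] \<pi> i"
          using occ[of i] that by simp
        with * have "i = n - 3" by blast
        with that n show False by simp
      qed
      moreover have "occurs_at [1, 2, 3] \<pi> k" using * by simp
      ultimately show "outcome True \<pi>"
        unfolding out occurs_at_triple by (simp add: pattern_free_def)
    next
      assume "outcome True \<pi>"
      then have w: "\<pi> ! k < \<pi> ! (k + 1)" "\<pi> ! (k + 1) < \<pi> ! (k + 2)" "pattern_free ((!) \<pi>) k"
        unfolding out by blast+
      have "\<rho> = [1, 2, 3] \<and> i = k" if "\<rho> \<in> {[1, 2, 3], [2, 3, 1]}" "occurs_at \<rho> \<pi> i" for \<rho> i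
      proof -
        have "i \<le> k \<and> match_at ((!) \<pi>) i" using that occ[of i] by blast
        with w(3) have "i = k" unfolding pattern_free_def using le_neq_implies_less by blast
        moreover have "\<not> occurs_at [2, 3, 1] \<pi> k"
          using w(1,2) unfolding occurs_at_triple by auto
        ultimately show ?thesis using that by blast
      qed
      moreover have "occurs_at [1, 2, 3] \<pi> k"
        unfolding occurs_at_triple using w(1,2) len n by simp
      ultimately show "3 \<le> n \<and> occurs_at [1, 2, 3] \<pi> (n - 3) \<and>
        (\<forall>\<rho>\<in>{[1, 2, 3], [2, 3, 1]}. \<forall>i. occurs_at \<rho> \<pi> i \<longrightarrow> \<rho> = [1, 2, 3] \<and> i = n - 3)"
        using True by simp
    qed
  qed (simp add: outcome_def wins_def len)
  note iff = this
  have len3: "length [1, 2, 3 :: nat] = 3" by simp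
  show ?thesis
    unfolding Av_end_def len3
  proof (rule Collect_cong)
    fix \<pi> :: "nat list"
    show "\<pi> \<in> permutations_of_set {1..n} \<and> 3 \<le> n \<and> occurs_at [1, 2, 3] \<pi> (n - 3) \<and>
        (\<forall>\<rho>\<in>{[1, 2, 3], [2, 3, 1]}. \<forall>i. occurs_at \<rho> \<pi> i \<longrightarrow> \<rho> = [1, 2, 3] \<and> i = n - 3)
      \<longleftrightarrow> \<pi> \<in> permutations_of_set {1..n} \<and> outcome True \<pi>"
    proof (rule conj_cong[OF refl])
      assume "\<pi> \<in> permutations_of_set {1..n}"
      then have "length \<pi> = n" by (simp add: length_finite_permutations_of_set)
      then show "3 \<le> n \<and> occurs_at [1, 2, 3] \<pi> (n - 3) \<and>
          (\<forall>\<rho>\<in>{[1, 2, 3], [2, 3, 1]}. \<forall>i. occurs_at \<rho> \<pi> i \<longrightarrow> \<rho> = [1, 2, 3] \<and> i = n - 3)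
        \<longleftrightarrow> outcome True \<pi>"
        by (rule iff)
    qed
  qed
qed

lemma sum_d: "(\<Sum>i=1..n. d n i) = card {\<pi> \<in> permutations_of_set {1..n}. outcome True \<pi>}"
proof -
  let ?S = "{\<pi> \<in> permutations_of_set {1..n}. outcome True \<pi>}"
  have "hd \<pi> \<in> {1..n}" if "\<pi> \<in> ?S" for \<pi>
  proof -
    have "\<pi> \<noteq> []" using that by (auto simp: outcome_def wins_def)
    then have "hd \<pi> \<in> set \<pi>" by simp
    moreover have "set \<pi> = {1..n}" using that by (blast dest: permutations_of_setD(1))
    ultimately show ?thesis by simp
  qed
  then have "?S = (\<Union>i\<in>{1..n}. {\<pi> \<in> ?S. hd \<pi> = i})" by auto
  also have "card \<dots> = (\<Sum>i=1..n. card {\<pi> \<in> ?S. hd \<pi> = i})"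
    by (rule card_UN_disjoint) auto
  finally show ?thesis unfolding d_def Av_end_eq by simp
qed

lemma order_type_outcome:
  fixes x :: "nat \<Rightarrow> 'a::linorder"
  assumes "\<pi> \<in> permutations_of_set {1..n}" "order_type n x \<pi>"
  shows "(if w then wins x n else pattern_free x (n - 2)) \<longleftrightarrow> outcome w \<pi>"
proof -
  have len: "length \<pi> = n" using assms(1) by (simp add: length_finite_permutations_of_set)
  have less: "x i < x j \<longleftrightarrow> \<pi> ! i < \<pi> ! j" if "i < n" "j < n" for i j
    using assms(2) that by (simp add: order_type_def)
  have pattern_free: "pattern_free x m \<longleftrightarrow> pattern_free ((!) \<pi>) m" if "m \<le> n - 2" for m
    unfolding pattern_free_def match_at_def using that less by (intro all_cong) auto
  show ?thesis
    using less pattern_free by (auto simp: outcome_def wins_def len)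
qed

section \<open>The series and its value\<close>

theorem corollary4p7:
  fixes M :: "'a measure" and X :: "nat \<Rightarrow> 'a \<Rightarrow> real"
  assumes "prob_space M"
    and indep: "prob_space.indep_vars M (\<lambda>_. borel) X UNIV"
    and ident: "\<And>m n. distr M borel (X m) = distr M borel (X n)"
    and cont: "\<And>n. continuous_on UNIV (cdf (distr M borel (X n)))"
  shows "((\<lambda>n. 1 / fact n * (\<Sum>i=1..n. real (d n i))) has_sum Pr_prec M X [1, 2, 3] [2, 3, 1]) {3..}
     \<and> \<bar>Pr_prec M X [1, 2, 3] [2, 3, 1] - 0.550\<bar> < 0.0005"
proof -
  interpret prob_space M by fact
  have rv[measurable]: "X k \<in> borel_measurable M" for k
    using indep by (auto simp: indep_vars_def)
  let ?p = "Pr_prec M X [1, 2, 3] [2, 3, 1]"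
  define W where "W n = {\<omega> \<in> space M. wins (\<lambda>i. X i \<omega>) n}" for n
  define C where "C n = {\<omega> \<in> space M. pattern_free (\<lambda>i. X i \<omega>) (n - 2)}" for n
  have W[measurable]: "W n \<in> events" for n
    unfolding W_def wins_def pattern_free_def match_at_def by measurable
  have C[measurable]: "C n \<in> events" for n
    unfolding C_def pattern_free_def match_at_def by measurable
  have "prob (W n) = real (card {\<pi> \<in> permutations_of_set {1..n}. outcome True \<pi>}) / fact n" for n
    unfolding W_def
    using W[of n] order_type_outcome[where w = True and n = n]
    by (intro prob_order_type[where Q = "\<lambda>x. wins x n", OF indep ident cont]) (auto simp: W_def)
  then have prob_W: "prob (W n) = 1 / fact n * (\<Sum>i=1..n. real (d n i))" for n
    by (simp only: sum_d[symmetric]) simp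
  have prob_C: "prob (C n) = real (card {\<pi> \<in> permutations_of_set {1..n}. outcome False \<pi>}) / fact n" for n
    unfolding C_def
    using C[of n] order_type_outcome[where w = False and n = n]
    by (intro prob_order_type[where Q = "\<lambda>x. pattern_free x (n - 2)", OF indep ident cont]) (auto simp: C_def)
  have p: "?p = prob (\<Union>n. W n)"
    unfolding Pr_prec_def first_occ_less_iff W_def by (rule arg_cong[where f = prob]) auto
  have disj: "disjoint_family W"
    unfolding disjoint_family_on_def W_def using wins_unique by blast
  have "(\<lambda>n. prob (W n)) sums ?p"
    unfolding p by (rule finite_measure_UNION[OF _ disj]) auto
  then have "((\<lambda>n. prob (W n)) has_sum ?p) UNIV"
    by (rule sums_nonneg_imp_has_sum) simp
  then have hs: "((\<lambda>n. prob (W n)) has_sum ?p) {3..}"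
    by (rule has_sum_cong_neutral[THEN iffD1, rotated -1]) (auto simp: W_def wins_def)

  have count: "prob (W n) = real (\<Sum>i<n. arrangement_count True n i) / fact n"
    "prob (C n) = real (\<Sum>i<n. arrangement_count False n i) / fact n" if "0 < n" for n
  proof -
    show "prob (W n) = real (\<Sum>i<n. arrangement_count True n i) / fact n"
      unfolding prob_W card_outcome[OF that, symmetric] sum_d[symmetric] by simp
    show "prob (C n) = real (\<Sum>i<n. arrangement_count False n i) / fact n"
      unfolding prob_C card_outcome[OF that] ..
  qed
  \<comment> \<open>\<open>21\<close> steps lead from the row with index \<open>3\<close> to the row with index \<open>24\<close>.\<close>
  obtain s where s: "snd (snd (snd (table True 21))) = s"
    "real_of_int s / fact 24 = (\<Sum>n=3..24. prob (W n))"
    using table[of True 21] by (auto simp: count simp del: arrangement_count.simps)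
  have r: "real_of_int (sum_list (fst (snd (snd (table False 21))))) / fact 24 = prob (C 24)"
    using table[of False 21] by (auto simp: count sum_list_count_row simp del: arrangement_count.simps)
  have partial: "(\<Sum>n=3..24. prob (W n)) = prob (\<Union>n\<in>{3..24}. W n)"
    using disj by (intro finite_measure_finite_Union[symmetric]) (auto simp: disjoint_family_on_def)
  have lower: "(\<Sum>n=3..24. prob (W n)) \<le> ?p"
    unfolding partial p by (intro finite_measure_mono) auto
  \<comment> \<open>A win after time \<open>24\<close> forces the first \<open>24\<close> entries to avoid both patterns.\<close>
  have "(\<Union>n. W n) \<subseteq> (\<Union>n\<in>{3..24}. W n) \<union> C 24"
  proof
    fix \<omega> assume "\<omega> \<in> (\<Union>n. W n)"
    then obtain n where n: "\<omega> \<in> W n" by blast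
    then have "3 \<le> n" by (simp add: W_def wins_def)
    show "\<omega> \<in> (\<Union>n\<in>{3..24}. W n) \<union> C 24"
    proof (cases "n \<le> 24")
      case True
      with n \<open>3 \<le> n\<close> show ?thesis by auto
    next
      case False
      with n have "\<omega> \<in> C 24" by (auto simp: W_def C_def wins_def pattern_free_def)
      then show ?thesis ..
    qed
  qed
  then have "?p \<le> prob ((\<Union>n\<in>{3..24}. W n) \<union> C 24)"
    unfolding p by (intro finite_measure_mono) auto
  also have "\<dots> \<le> (\<Sum>n=3..24. prob (W n)) + prob (C 24)"
    unfolding partial by (intro measure_Un_le) auto
  finally have upper: "?p \<le> (\<Sum>n=3..24. prob (W n)) + prob (C 24)" .

  have "real_of_int (5495 * fact 24) < real_of_int (10000 * s)"
    "real_of_int (10000 * (s + sum_list (fst (snd (snd (table False 21)))))) < real_of_int (5505 * fact 24)"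
    using table_values unfolding s(1) by (simp_all only: of_int_less_iff)
  then have "1099 / 2000 < real_of_int s / fact 24"
    "real_of_int s / fact 24 + real_of_int (sum_list (fst (snd (snd (table False 21))))) / fact 24 < 1101 / 2000"
    by (simp_all add: field_simps del: fact_numeral)
  with lower upper have "1099 / 2000 < ?p" "?p < 1101 / 2000"
    unfolding s(2) r by linarith+
  moreover have "(0.550 :: real) = 11 / 20" "(0.0005 :: real) = 1 / 2000" by simp_all
  ultimately have "\<bar>?p - 0.550\<bar> < 0.0005"
    unfolding abs_less_iff by linarith
  with hs show ?thesis unfolding prob_W by simp
qed

end
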